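(* Let $\Omega\subset\mathbb{R}^n$ be a nonempty bounded open set. Then the following hold. (i) If $0\le a\in C^{1,\alpha}(\overline\Omega)$ for some $\alpha\in(0,1]$ and $a>0$ on $\partial\Omega$, then $a\in\mathcal{Z}^{1+\alpha}(\Omega)$. (ii) There exists $0\le a\in C^\infty(\overline\Omega)$ such that $a>0$ on $\partial\Omega$, $a\in\mathcal{Z}^2(\Omega)$, and $a\notin\mathcal{Z}^{2+\varepsilon}(\Omega)$ for any $\varepsilon>0$.
   Context: For $\varkappa\in(0,\infty)$, the class $\mathcal{Z}^\varkappa(\Omega)$ consists of all functions $a:\Omega\to[0,\infty)$ for which there is a constant $C>0$ such that $a(x)\le C\,(a(y)+|x-y|^\varkappa)$ for all $x,y\in\Omega$. $C^{1,\alpha}(\overline\Omega)$ denotes the functions that are $C^1$ in $\Omega$, with the function and its gradient extending continuously to $\overline\Omega$, and with gradient $\alpha$-Hölder continuous (i.e. $|\nabla a(x)-\nabla a(y)|\le C|x-y|^\alpha$ for all $x,y$). *)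

theory Defs
  imports "HOL-Analysis.Analysis"
begin

text \<open>
  A function on \<open>\<Omega>\<close> that extends continuously to the closure is represented by a total
  function whose values on \<open>closure \<Omega>\<close> are those of the extension; in particular its
  values on \<open>frontier \<Omega>\<close> are the boundary values.  Values outside \<open>closure \<Omega>\<close> are irrelevant.
\<close>

definition Z_class :: "real \<Rightarrow> (real ^ 'n) set \<Rightarrow> (real ^ 'n \<Rightarrow> real) set" where
  "Z_class \<kappa> \<Omega> = {a. (\<forall>x\<in>\<Omega>. 0 \<le> a x) \<and>
     (\<exists>C>0. \<forall>x\<in>\<Omega>. \<forall>y\<in>\<Omega>. a x \<le> C * (a y + norm (x - y) powr \<kappa>))}"

text \<open>
  \<open>g\<close> is the gradient of \<open>a\<close> in the open set \<open>\<Omega>\<close>, continuously extended to the closure.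
  On \<open>closure \<Omega>\<close> it is uniquely determined by \<open>a\<close>.
\<close>

definition gradient_upto_closure ::
    "(real ^ 'n) set \<Rightarrow> (real ^ 'n \<Rightarrow> real) \<Rightarrow> (real ^ 'n \<Rightarrow> real ^ 'n) \<Rightarrow> bool" where
  "gradient_upto_closure \<Omega> a g \<longleftrightarrow>
     (\<forall>x\<in>\<Omega>. GDERIV a x :> g x) \<and> continuous_on (closure \<Omega>) g"

definition C1_Hoelder_closure :: "real \<Rightarrow> (real ^ 'n) set \<Rightarrow> (real ^ 'n \<Rightarrow> real) set" where
  "C1_Hoelder_closure \<alpha> \<Omega> = {a. continuous_on (closure \<Omega>) a \<and>
     (\<exists>g. gradient_upto_closure \<Omega> a g \<and>
        (\<exists>C. \<forall>x\<in>\<Omega>. \<forall>y\<in>\<Omega>. norm (g x - g y) \<le> C * norm (x - y) powr \<alpha>))}"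

text \<open>
  \<open>Ck_closure k \<Omega>\<close>: all partial derivatives of order at most \<open>k\<close> exist in \<open>\<Omega>\<close> and, like the
  function itself, extend continuously to the closure.
\<close>

primrec Ck_closure :: "nat \<Rightarrow> (real ^ 'n) set \<Rightarrow> (real ^ 'n \<Rightarrow> real) set" where
  "Ck_closure 0 \<Omega> = {a. continuous_on (closure \<Omega>) a}"
| "Ck_closure (Suc k) \<Omega> = {a. continuous_on (closure \<Omega>) a \<and>
     (\<exists>g. gradient_upto_closure \<Omega> a g \<and> (\<forall>i. (\<lambda>x. g x $ i) \<in> Ck_closure k \<Omega>))}"

definition Cinf_closure :: "(real ^ 'n) set \<Rightarrow> (real ^ 'n \<Rightarrow> real) set" where
  "Cinf_closure \<Omega> = (\<Inter>k. Ck_closure k \<Omega>)"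

end

theory Submission
  imports Defs
begin

text \<open>
  (i) Near a point \<open>y\<close> where \<open>a\<close> is small, a ball of uniform radius around \<open>y\<close> lies in \<open>\<Omega>\<close>.
  For \<open>x\<close> in that ball, nonnegativity of \<open>a\<close> at the reflected point \<open>2y - x\<close> and the first-order
  Taylor estimate with Hoelder remainder bound \<open>\<nabla>a(y) \<bullet> (x - y)\<close> from above, and the Taylor
  estimate at \<open>x\<close> then gives \<open>a(x) \<le> 2 (a(y) + C |x - y|\<^sup>1\<^sup>+\<^sup>\<alpha>)\<close>. Away from this
  situation \<open>a(y)\<close> or \<open>|x - y|\<close> is bounded below, and boundedness of \<open>a\<close> suffices.

  (ii) The witness is \<open>a(x) = |x - x\<^sub>0|\<^sup>2\<close> with \<open>x\<^sub>0 \<in> \<Omega>\<close>.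
\<close>

text \<open>The mean value theorem along the segment writes the increment as
  \<open>h \<bullet> g\<close> at an intermediate point; subtracting \<open>h \<bullet> g y\<close>
  leaves a difference of gradients, to which the bound \<open>H\<close> applies. Integrating instead
  would give the sharper constant \<open>C / (1 + \<alpha>)\<close>, but \<open>C\<close>
  suffices.\<close>

lemma GDERIV_taylor_Hoelder:
  fixes a :: "'a::real_inner \<Rightarrow> real"
  assumes D: "\<And>z. z \<in> closed_segment y x \<Longrightarrow> GDERIV a z :> g z"
    and H: "\<And>z. z \<in> closed_segment y x \<Longrightarrow> norm (g z - g y) \<le> C * norm (z - y) powr \<alpha>"
    and "0 \<le> C" "0 \<le> \<alpha>"
  shows "\<bar>a x - a y - (x - y) \<bullet> g y\<bar> \<le> C * norm (x - y) powr (1 + \<alpha>)"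
proof -
  define h where "h = x - y"
  define f where "f = (\<lambda>t. a (y + t *\<^sub>R h))"
  have seg: "y + t *\<^sub>R h \<in> closed_segment y x" if "0 \<le> t" "t \<le> 1" for t
    using that unfolding in_segment h_def by (intro exI[of _ t]) (auto simp: algebra_simps)
  have der: "(f has_derivative (\<lambda>s. (s *\<^sub>R h) \<bullet> g (y + t *\<^sub>R h))) (at t)" if "0 \<le> t" "t \<le> 1" for t
    unfolding f_def
    by (rule has_derivative_compose[where f = "\<lambda>t. y + t *\<^sub>R h" and g = a])
      (use D[OF seg[OF that]] in \<open>auto simp: gderiv_def intro!: derivative_eq_intros\<close>)
  have f': "(f has_real_derivative h \<bullet> g (y + t *\<^sub>R h)) (at t)" if "0 \<le> t" "t \<le> 1" for t
    by (rule has_derivative_imp_has_field_derivative[OF der[OF that]]) simp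
  obtain t where t: "0 < t" "t < 1" "f 1 - f 0 = h \<bullet> g (y + t *\<^sub>R h)"
    using MVT2[of 0 1 f "\<lambda>t. h \<bullet> g (y + t *\<^sub>R h)"] f' by auto
  have "a x - a y - (x - y) \<bullet> g y = h \<bullet> (g (y + t *\<^sub>R h) - g y)"
    using t(3) by (simp add: f_def h_def inner_diff_right)
  also have "\<bar>\<dots>\<bar> \<le> norm h * norm (g (y + t *\<^sub>R h) - g y)"
    by (rule Cauchy_Schwarz_ineq2)
  also have "\<dots> \<le> norm h * (C * norm h powr \<alpha>)"
  proof (rule mult_left_mono)
    have "norm (g (y + t *\<^sub>R h) - g y) \<le> C * norm (t *\<^sub>R h) powr \<alpha>"
      using H[OF seg, of t] t by simp
    also have "\<dots> \<le> C * norm h powr \<alpha>"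
      using t assms(3,4) by (intro mult_left_mono powr_mono2) (auto simp: mult_left_le_one_le)
    finally show "norm (g (y + t *\<^sub>R h) - g y) \<le> C * norm h powr \<alpha>" .
  qed simp
  \<comment> \<open>If \<open>h = 0\<close>, both sides vanish, since
    \<open>0 powr s = 0\<close>.\<close>
  also have "\<dots> = C * norm h powr (1 + \<alpha>)"
    by (simp add: powr_add)
  finally show ?thesis by (simp add: h_def)
qed

lemma nonneg_C1_Hoelder_in_Z_class:
  fixes \<Omega> :: "(real ^ 'n) set"
  assumes bdd: "bounded \<Omega>" and op: "open \<Omega>" and "0 < \<alpha>"
    and a: "a \<in> C1_Hoelder_closure \<alpha> \<Omega>"
    and nonneg: "\<And>x. x \<in> closure \<Omega> \<Longrightarrow> 0 \<le> a x"
    and pos: "\<And>x. x \<in> frontier \<Omega> \<Longrightarrow> 0 < a x"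
  shows "a \<in> Z_class (1 + \<alpha>) \<Omega>"
proof -
  have cont: "continuous_on (closure \<Omega>) a" using a by (simp add: C1_Hoelder_closure_def)
  have "\<exists>g. gradient_upto_closure \<Omega> a g \<and>
      (\<exists>L. \<forall>x\<in>\<Omega>. \<forall>y\<in>\<Omega>. norm (g x - g y) \<le> L * norm (x - y) powr \<alpha>)"
    using a by (simp add: C1_Hoelder_closure_def)
  then obtain g L where g: "gradient_upto_closure \<Omega> a g"
    and "\<forall>x\<in>\<Omega>. \<forall>y\<in>\<Omega>. norm (g x - g y) \<le> L * norm (x - y) powr \<alpha>"
    by (elim exE conjE)
  then have L: "norm (g x - g y) \<le> L * norm (x - y) powr \<alpha>" if "x \<in> \<Omega>" "y \<in> \<Omega>" for x y
    using that by blast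
  have D: "GDERIV a x :> g x" if "x \<in> \<Omega>" for x
    using g that by (simp add: gradient_upto_closure_def)
  have cpt: "compact (closure \<Omega>)" using bdd by simp
  have sub: "x \<in> closure \<Omega>" if "x \<in> \<Omega>" for x using that closure_subset by blast
  obtain M where M: "0 < M" "\<And>x. x \<in> closure \<Omega> \<Longrightarrow> a x \<le> M"
  proof -
    have "bounded (a ` closure \<Omega>)"
      using compact_continuous_image[OF cont cpt] by (rule compact_imp_bounded)
    then obtain B where "0 < B" "\<And>x. x \<in> closure \<Omega> \<Longrightarrow> norm (a x) \<le> B"
      unfolding bounded_pos by auto
    then show thesis using that[of B] by force
  qed
  \<comment> \<open>Half the minimum of \<open>a\<close> on the compact frontier makes the bound
    strict. An empty frontier, which occurs for empty \<open>\<Omega>\<close>, allows any positive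
    \<open>m\<close>.\<close>
  obtain m where m: "0 < m" "\<And>x. x \<in> frontier \<Omega> \<Longrightarrow> m < a x"
  proof (cases "frontier \<Omega> = {}")
    case False
    have "continuous_on (frontier \<Omega>) a"
      using cont by (rule continuous_on_subset) (simp add: frontier_def)
    then obtain z where "z \<in> frontier \<Omega>" "\<And>x. x \<in> frontier \<Omega> \<Longrightarrow> a z \<le> a x"
      using continuous_attains_inf[OF compact_frontier_bounded[OF bdd] False] by blast
    then show thesis using pos[of z] that[of "a z / 2"] by force
  qed (use that[of 1] in auto)
  \<comment> \<open>This sublevel set is compact and, as \<open>a > m\<close> on the frontier, stays
    inside \<open>\<Omega>\<close>. Hence one radius \<open>r\<close> serves all its points.\<close>
  define S where "S = closure \<Omega> \<inter> a -` {..m}"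
  have "compact S"
    using continuous_closed_preimage[OF cont closed_closure closed_atMost, of m] cpt
    unfolding S_def compact_eq_bounded_closed by (auto intro: bounded_subset)
  moreover have "S \<subseteq> \<Omega>"
  proof
    fix x assume "x \<in> S"
    then have "x \<in> closure \<Omega>" "x \<notin> frontier \<Omega>" using m(2)[of x] by (auto simp: S_def)
    then show "x \<in> \<Omega>" using op by (simp add: frontier_def interior_open)
  qed
  ultimately obtain r where "0 < r" and r_sub: "(\<Union>y\<in>S. ball y r) \<subseteq> \<Omega>"
    using compact_subset_open_imp_ball_epsilon_subset[of S \<Omega>] op by blast
  then have r: "0 < r" "\<And>y. y \<in> S \<Longrightarrow> ball y r \<subseteq> \<Omega>" by blast+
  \<comment> \<open>One summand per case: \<open>M / m\<close> for \<open>a y\<close> large,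
    \<open>M / r powr (1 + \<alpha>)\<close> for distant points, \<open>2\<close> and
    \<open>2 * \<bar>L\<bar>\<close> for the Taylor estimate. The absolute value is taken because
    \<open>L\<close> has no prescribed sign.\<close>
  define K where "K = 2 + M / m + M / r powr (1 + \<alpha>) + 2 * \<bar>L\<bar>"
  have pos_terms: "0 < M / m" "0 < M / r powr (1 + \<alpha>)" using M m r by simp_all
  have K: "2 \<le> K" "M / m \<le> K" "M / r powr (1 + \<alpha>) \<le> K" "2 * \<bar>L\<bar> \<le> K"
    using pos_terms unfolding K_def by linarith+
  have "a x \<le> K * (a y + norm (x - y) powr (1 + \<alpha>))" (is "_ \<le> K * (_ + ?d)")
    if x: "x \<in> \<Omega>" and y: "y \<in> \<Omega>" for x y
  proof -
    have ay: "0 \<le> a y" and ax: "a x \<le> M" using nonneg M x y sub by auto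
    consider "m < a y" | "r \<le> norm (x - y)" | "y \<in> S" "norm (x - y) < r"
      unfolding S_def using sub[OF y] by force
    then show ?thesis
    proof cases
      case 1
      have "a x \<le> M / m * m" using ax m by simp
      also have "\<dots> \<le> K * (a y + ?d)"
        using 1 K m pos_terms by (intro mult_mono) (auto intro: add_increasing2)
      finally show ?thesis .
    next
      case 2
      have "a x \<le> M / r powr (1 + \<alpha>) * r powr (1 + \<alpha>)" using ax r by simp
      also have "\<dots> \<le> K * (a y + ?d)"
      proof (rule mult_mono)
        have "r powr (1 + \<alpha>) \<le> ?d" using 2 r \<open>0 < \<alpha>\<close> by (intro powr_mono2) auto
        then show "r powr (1 + \<alpha>) \<le> a y + ?d" using ay by simp
      qed (use K in auto)
      finally show ?thesis .
    next
      case 3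
      \<comment> \<open>Convexity of the ball keeps the segment inside \<open>\<Omega>\<close>,
        which itself may fail to be convex.\<close>
      have taylor: "\<bar>a z - a y - (z - y) \<bullet> g y\<bar> \<le> \<bar>L\<bar> * norm (z - y) powr (1 + \<alpha>)"
        if "z \<in> ball y r" for z
      proof (rule GDERIV_taylor_Hoelder)
        fix w assume "w \<in> closed_segment y z"
        then have w: "w \<in> \<Omega>"
          using r(2)[OF 3(1)] that closed_segment_subset[of y "ball y r" z] r(1) by auto
        then show "GDERIV a w :> g w" by (rule D)
        have "norm (g w - g y) \<le> L * norm (w - y) powr \<alpha>" by (rule L[OF w y])
        also have "\<dots> \<le> \<bar>L\<bar> * norm (w - y) powr \<alpha>" by (intro mult_right_mono) auto
        finally show "norm (g w - g y) \<le> \<bar>L\<bar> * norm (w - y) powr \<alpha>" .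
      qed (use \<open>0 < \<alpha>\<close> in auto)
      define z where "z = y - (x - y)"
      have zy: "z - y = - (x - y)" and nz: "norm (z - y) = norm (x - y)"
        by (simp_all add: z_def norm_minus_commute)
      have "x \<in> ball y r" "z \<in> ball y r"
        using 3(2) nz by (simp_all add: mem_ball dist_norm norm_minus_commute)
      moreover have "0 \<le> a z" using nonneg sub r(2)[OF 3(1)] \<open>z \<in> ball y r\<close> by blast
      \<comment> \<open>At \<open>z\<close>, nonnegativity gives
        \<open>(x - y) \<bullet> g y \<le> a y + \<bar>L\<bar> * ?d\<close>; inserting this into the
        upper estimate at \<open>x\<close> doubles both terms.\<close>
      ultimately have "a x \<le> 2 * a y + 2 * \<bar>L\<bar> * ?d"
        using taylor[of x] taylor[of z] unfolding zy inner_minus_left norm_minus_cancel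
        by argo
      also have "\<dots> \<le> K * a y + K * ?d"
        using K ay by (intro add_mono mult_right_mono) auto
      finally show ?thesis by (simp add: distrib_left)
    qed
  qed
  moreover have "0 < K" using K by linarith
  ultimately show ?thesis
    unfolding Z_class_def using nonneg sub by auto
qed

text \<open>Smoothness of the witness descends from quadratic to affine to constant functions. Only
  here is induction on \<open>k\<close> required, since the zero gradient is again constant; the two
  higher degrees need just a case split.\<close>

lemma const_in_Ck_closure: "(\<lambda>x :: real ^ 'n. c) \<in> Ck_closure k \<Omega>"
proof (induction k arbitrary: c)
  case (Suc k)
  have "gradient_upto_closure \<Omega> (\<lambda>x :: real ^ 'n. c) (\<lambda>x. 0)"
    by (simp add: gradient_upto_closure_def GDERIV_const)
  then show ?case using Suc by (auto intro!: exI[of _ "\<lambda>x. 0"])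
qed simp

lemma affine_component_in_Ck_closure:
  "(\<lambda>x :: real ^ 'n. c * (x - p) $ i) \<in> Ck_closure k \<Omega>"
proof (cases k)
  case (Suc k')
  have "gradient_upto_closure \<Omega> (\<lambda>x. c * (x - p) $ i) (\<lambda>x. axis i c)"
    unfolding gradient_upto_closure_def gderiv_def
    by (auto intro!: derivative_eq_intros bounded_linear.has_derivative[OF bounded_linear_vec_nth]
        simp: inner_axis mult.commute)
  then show ?thesis
    using Suc const_in_Ck_closure by (auto intro!: continuous_intros exI[of _ "\<lambda>x. axis i c"])
qed (auto intro!: continuous_intros)

lemma norm_squared_in_Cinf_closure:
  "(\<lambda>x :: real ^ 'n. (norm (x - p))\<^sup>2) \<in> Cinf_closure \<Omega>"
proof -
  have "(\<lambda>x. (norm (x - p))\<^sup>2) \<in> Ck_closure k \<Omega>" for k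
  proof (cases k)
    case (Suc k')
    have "gradient_upto_closure \<Omega> (\<lambda>x. (norm (x - p))\<^sup>2) (\<lambda>x. 2 *\<^sub>R (x - p))"
      unfolding gradient_upto_closure_def gderiv_def power2_norm_eq_inner
      by (auto intro!: derivative_eq_intros continuous_intros simp: inner_commute)
    moreover have "(\<lambda>x. (2 *\<^sub>R (x - p)) $ i) \<in> Ck_closure k' \<Omega>" for i
      using affine_component_in_Ck_closure[of 2 p i k' \<Omega>] by simp
    ultimately show ?thesis
      using Suc by (auto intro!: continuous_intros exI[of _ "\<lambda>x. 2 *\<^sub>R (x - p)"])
  qed (auto intro!: continuous_intros)
  then show ?thesis by (simp add: Cinf_closure_def)
qed

text \<open>Triangle inequality, then
  \<open>(s + t)\<^sup>2 \<le> 2 * (s\<^sup>2 + t\<^sup>2)\<close>, which is where the constant 2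
  comes from.\<close>

lemma norm_squared_in_Z_class:
  "(\<lambda>x :: real ^ 'n. (norm (x - p))\<^sup>2) \<in> Z_class 2 \<Omega>"
proof -
  have "(norm (x - p))\<^sup>2 \<le> 2 * ((norm (y - p))\<^sup>2 + norm (x - y) powr 2)" for x y :: "real ^ 'n"
  proof -
    have "norm (x - p) \<le> norm (y - p) + norm (x - y)"
      using norm_triangle_ineq[of "y - p" "x - y"] by simp
    then have "(norm (x - p))\<^sup>2 \<le> (norm (y - p) + norm (x - y))\<^sup>2"
      by (intro power_mono) auto
    also have "\<dots> \<le> 2 * ((norm (y - p))\<^sup>2 + (norm (x - y))\<^sup>2)"
      using sum_squares_bound[of "norm (y - p)" "norm (x - y)"] by (simp add: power2_sum)
    finally show ?thesis by simp
  qed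
  then show ?thesis unfolding Z_class_def by (auto intro!: exI[of _ 2])
qed

text \<open>Taking \<open>y = p\<close>, where the function vanishes, membership would force
  \<open>t\<^sup>2 \<le> C * t powr (2 + \<epsilon>)\<close> at distance \<open>t\<close> from
  \<open>p\<close>, which fails for small \<open>t\<close>.\<close>

lemma norm_squared_notin_Z_class:
  fixes p :: "real ^ 'n"
  assumes "open \<Omega>" "p \<in> \<Omega>" "0 < \<epsilon>"
  shows "(\<lambda>x. (norm (x - p))\<^sup>2) \<notin> Z_class (2 + \<epsilon>) \<Omega>"
proof
  assume "(\<lambda>x. (norm (x - p))\<^sup>2) \<in> Z_class (2 + \<epsilon>) \<Omega>"
  then obtain C where "0 < C"
    and C: "\<And>x. x \<in> \<Omega> \<Longrightarrow> (norm (x - p))\<^sup>2 \<le> C * norm (x - p) powr (2 + \<epsilon>)"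
    using \<open>p \<in> \<Omega>\<close> unfolding Z_class_def by fastforce
  obtain r where r: "0 < r" "ball p r \<subseteq> \<Omega>"
    using assms openE by blast
  \<comment> \<open>The first bound keeps the sphere of radius \<open>t\<close> about
    \<open>p\<close> inside \<open>\<Omega>\<close>; the second makes
    \<open>C * t powr \<epsilon>\<close> at most 1/2.\<close>
  define t where "t = min (r / 2) ((1 / (2 * C)) powr (1 / \<epsilon>))"
  have t: "0 < t" "t < r" using r \<open>0 < C\<close> by (auto simp: t_def)
  have "t powr \<epsilon> \<le> ((1 / (2 * C)) powr (1 / \<epsilon>)) powr \<epsilon>"
    using t \<open>0 < \<epsilon>\<close> by (intro powr_mono2) (auto simp: t_def)
  also have "\<dots> = 1 / (2 * C)" using \<open>0 < \<epsilon>\<close> \<open>0 < C\<close> by (simp add: powr_powr)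
  finally have small: "C * t powr \<epsilon> < 1" using \<open>0 < C\<close> by (simp add: field_simps)
  obtain u :: "real ^ 'n" where u: "norm u = t" using t vector_choose_size[of t] by auto
  have "p + u \<in> \<Omega>" using r t u by (auto simp: subset_iff dist_norm)
  from C[OF this] have "t\<^sup>2 * 1 \<le> t\<^sup>2 * (C * t powr \<epsilon>)"
    using u t by (simp add: powr_add mult_ac)
  then show False using small t by simp
qed

theorem proposition1p3:
  fixes \<Omega> :: "(real ^ 'n) set"
  assumes "\<Omega> \<noteq> {}" and "bounded \<Omega>" and "open \<Omega>"
  shows "(\<forall>(a :: real ^ 'n \<Rightarrow> real) (\<alpha> :: real).
            0 < \<alpha> \<and> \<alpha> \<le> 1 \<and> a \<in> C1_Hoelder_closure \<alpha> \<Omega> \<and>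
            (\<forall>x\<in>closure \<Omega>. 0 \<le> a x) \<and> (\<forall>x\<in>frontier \<Omega>. 0 < a x)
            \<longrightarrow> a \<in> Z_class (1 + \<alpha>) \<Omega>) \<and>
         (\<exists>a :: real ^ 'n \<Rightarrow> real.
            a \<in> Cinf_closure \<Omega> \<and>
            (\<forall>x\<in>closure \<Omega>. 0 \<le> a x) \<and> (\<forall>x\<in>frontier \<Omega>. 0 < a x) \<and>
            a \<in> Z_class 2 \<Omega> \<and>
            (\<forall>\<epsilon>>0. a \<notin> Z_class (2 + \<epsilon>) \<Omega>))"
proof -
  obtain p where p: "p \<in> \<Omega>" using assms(1) by blast
  \<comment> \<open>The witness vanishes only at \<open>p\<close>, an interior point, so it is
    positive on the frontier.\<close>
  have "p \<notin> frontier \<Omega>" using p assms(3) by (simp add: frontier_def interior_open)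
  then have "\<forall>x\<in>frontier \<Omega>. 0 < (norm (x - p))\<^sup>2" by auto
  then have "\<exists>a. a \<in> Cinf_closure \<Omega> \<and>
      (\<forall>x\<in>closure \<Omega>. 0 \<le> a x) \<and> (\<forall>x\<in>frontier \<Omega>. 0 < a x) \<and>
      a \<in> Z_class 2 \<Omega> \<and> (\<forall>\<epsilon>>0. a \<notin> Z_class (2 + \<epsilon>) \<Omega>)"
    using norm_squared_in_Cinf_closure norm_squared_in_Z_class
      norm_squared_notin_Z_class[OF assms(3) p]
    by (intro exI[of _ "\<lambda>x. (norm (x - p))\<^sup>2"] conjI ballI allI impI) simp_all
  moreover have "a \<in> Z_class (1 + \<alpha>) \<Omega>"
    if "0 < \<alpha> \<and> \<alpha> \<le> 1 \<and> a \<in> C1_Hoelder_closure \<alpha> \<Omega> \<and>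
      (\<forall>x\<in>closure \<Omega>. 0 \<le> a x) \<and> (\<forall>x\<in>frontier \<Omega>. 0 < a x)" for a \<alpha>
    by (rule nonneg_C1_Hoelder_in_Z_class[OF assms(2,3)]) (use that in simp_all)
  ultimately show ?thesis by simp
qed

end
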